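(* Let $D\subset\mathbb{R}^d$ be compact, let $\mathcal{B}$ be the space of continuous real-valued functions on $D$, and let $Z=(Z_{\mathbf{x}})_{\mathbf{x}\in D}$ be a centred Gaussian random field with continuous covariance kernel $k:D\times D\to\mathbb{R}$ and with paths in $\mathcal{B}$. Let $T:\mathcal{B}\to\mathbb{R}^D$ be a linear map such that, for every $\mathbf{x}\in D$, $T(Z)_{\mathbf{x}}$ is a centred square-integrable random variable and $T(Z)_{\mathbf{x}}\in\mathcal{L}(Z)$. Let $\mathcal{T}:\mathcal{H}\to\mathbb{R}^D$ be the operator associated with $T$ (defined in the context). Then the following three conditions are equivalent: (i) $Z=T(Z)$ up to a modification, i.e. $\mathbb{P}(Z_{\mathbf{x}}=T(Z)_{\mathbf{x}})=1$ for all $\mathbf{x}\in D$; (ii) $\mathcal{T}(k(\cdot,\mathbf{x}'))=k(\cdot,\mathbf{x}')$ for all $\mathbf{x}'\in D$; (iii) $\mathcal{T}=\mathrm{Id}_{\mathcal{H}}$, i.e. $\mathcal{T}(h)=h$ for all $h\in\mathcal{H}$.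
   Context: $T(Z)_{\mathbf{x}}(\omega)=T(Z_{\cdot}(\omega))(\mathbf{x})$, i.e. $T$ acts on the paths of $Z$. $\mathcal{H}$ is the reproducing kernel Hilbert space of $k$: the functional completion $\overline{\mathrm{span}(k(\cdot,\mathbf{x}),\mathbf{x}\in D)}$ for the scalar product determined by $\langle k(\cdot,\mathbf{x}),k(\cdot,\mathbf{x}')\rangle_{\mathcal{H}}=k(\mathbf{x},\mathbf{x}')$. $\mathcal{L}(Z)=\overline{\mathrm{span}(Z_{\mathbf{x}},\mathbf{x}\in D)}$ is the Hilbert space generated by $Z$, the closure being taken in $L^2(\mathbb{P})$ (equivalence classes of square-integrable random variables). The operator $\mathcal{T}:\mathcal{H}\to\mathbb{R}^D$ associated with $T$ is the unique linear operator satisfying $\operatorname{cov}(T(Z)_{\mathbf{x}},Z_{\mathbf{x}'})=\mathcal{T}(k(\cdot,\mathbf{x}'))(\mathbf{x})$ for all $\mathbf{x},\mathbf{x}'\in D$ and such that $\mathcal{T}(h_n)(\mathbf{x})\to\mathcal{T}(h)(\mathbf{x})$ for all $\mathbf{x}\in D$ whenever $h_n\to h$ in $\mathcal{H}$ (such an operator exists and is unique under the stated hypotheses). *)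

theory Defs
  imports "HOL-Probability.Probability"
begin

section \<open>Function spaces\<close>

text \<open>A real-valued function on \<open>D\<close> is encoded as a function on the whole type that vanishes
  outside \<open>D\<close>. Thus two functions on \<open>D\<close> are equal iff their encodings are equal, and the encodings
  are closed under pointwise sums and scalar multiples.\<close>

definition on_dom :: "'a set \<Rightarrow> ('a \<Rightarrow> real) \<Rightarrow> 'a \<Rightarrow> real" where
  "on_dom D f = (\<lambda>x. if x \<in> D then f x else 0)"

definition fun_space :: "'a set \<Rightarrow> ('a \<Rightarrow> real) set" where
  "fun_space D = {f. \<forall>x. x \<notin> D \<longrightarrow> f x = 0}"

definition cont_fun_space :: "'a::topological_space set \<Rightarrow> ('a \<Rightarrow> real) set" where
  "cont_fun_space D = {f \<in> fun_space D. continuous_on D f}"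

definition linear_map_on ::
    "('a \<Rightarrow> real) set \<Rightarrow> ('a \<Rightarrow> real) set \<Rightarrow> (('a \<Rightarrow> real) \<Rightarrow> 'a \<Rightarrow> real) \<Rightarrow> bool" where
  "linear_map_on V W T \<longleftrightarrow>
     (\<forall>f\<in>V. T f \<in> W) \<and>
     (\<forall>f\<in>V. \<forall>g\<in>V. T (\<lambda>x. f x + g x) = (\<lambda>x. T f x + T g x)) \<and>
     (\<forall>c. \<forall>f\<in>V. T (\<lambda>x. c * f x) = (\<lambda>x. c * T f x))"


section \<open>Random fields\<close>

definition covariance :: "'w measure \<Rightarrow> ('w \<Rightarrow> real) \<Rightarrow> ('w \<Rightarrow> real) \<Rightarrow> real" where
  "covariance M X Y =
     (LINT \<omega>|M. (X \<omega> - integral\<^sup>L M X) * (Y \<omega> - integral\<^sup>L M Y))"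

definition square_integrable :: "'w measure \<Rightarrow> ('w \<Rightarrow> real) \<Rightarrow> bool" where
  "square_integrable M X \<longleftrightarrow> X \<in> borel_measurable M \<and> integrable M (\<lambda>\<omega>. (X \<omega>)\<^sup>2)"

text \<open>Degenerate (almost surely constant) Gaussian variables are admitted.\<close>

definition gaussian_rv :: "'w measure \<Rightarrow> ('w \<Rightarrow> real) \<Rightarrow> bool" where
  "gaussian_rv M X \<longleftrightarrow>
     (\<exists>\<mu> \<sigma>. 0 < \<sigma> \<and> distributed M lborel X (normal_density \<mu> \<sigma>)) \<or>
     (X \<in> borel_measurable M \<and> (\<exists>\<mu>. AE \<omega> in M. X \<omega> = \<mu>))"

definition centred_gaussian_field :: "'w measure \<Rightarrow> 'a set \<Rightarrow> ('a \<Rightarrow> 'w \<Rightarrow> real) \<Rightarrow> bool" where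
  "centred_gaussian_field M D Z \<longleftrightarrow>
     (\<forall>F a. finite F \<and> F \<subseteq> D \<longrightarrow> gaussian_rv M (\<lambda>\<omega>. \<Sum>x\<in>F. a x * Z x \<omega>)) \<and>
     (\<forall>x\<in>D. integral\<^sup>L M (Z x) = 0)"

definition sample_path :: "'a set \<Rightarrow> ('a \<Rightarrow> 'w \<Rightarrow> real) \<Rightarrow> 'w \<Rightarrow> 'a \<Rightarrow> real" where
  "sample_path D Z \<omega> = on_dom D (\<lambda>x. Z x \<omega>)"

definition apply_paths ::
    "'a set \<Rightarrow> (('a \<Rightarrow> real) \<Rightarrow> 'a \<Rightarrow> real) \<Rightarrow> ('a \<Rightarrow> 'w \<Rightarrow> real) \<Rightarrow> 'a \<Rightarrow> 'w \<Rightarrow> real" where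
  "apply_paths D T Z = (\<lambda>x \<omega>. T (sample_path D Z \<omega>) x)"

definition field_span :: "'a set \<Rightarrow> ('a \<Rightarrow> 'w \<Rightarrow> real) \<Rightarrow> ('w \<Rightarrow> real) set" where
  "field_span D Z = {Y. \<exists>F a. finite F \<and> F \<subseteq> D \<and> Y = (\<lambda>\<omega>. \<Sum>x\<in>F. a x * Z x \<omega>)}"

text \<open>The closure of the span in \<open>L\<^sup>2\<close>, as a set of representatives: membership depends only on the
  almost-sure equivalence class of a random variable.\<close>

definition gaussian_space :: "'w measure \<Rightarrow> 'a set \<Rightarrow> ('a \<Rightarrow> 'w \<Rightarrow> real) \<Rightarrow> ('w \<Rightarrow> real) set" where
  "gaussian_space M D Z =
     {X. square_integrable M X \<and>
         (\<forall>\<epsilon>>0. \<exists>Y\<in>field_span D Z. sqrt (LINT \<omega>|M. (X \<omega> - Y \<omega>)\<^sup>2) < \<epsilon>)}"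


section \<open>The reproducing kernel Hilbert space as a functional completion\<close>

definition kernel_section :: "'a set \<Rightarrow> ('a \<Rightarrow> 'a \<Rightarrow> real) \<Rightarrow> 'a \<Rightarrow> 'a \<Rightarrow> real" where
  "kernel_section D k x = on_dom D (\<lambda>y. k y x)"

definition kernel_comb ::
    "'a set \<Rightarrow> ('a \<Rightarrow> 'a \<Rightarrow> real) \<Rightarrow> 'a set \<Rightarrow> ('a \<Rightarrow> real) \<Rightarrow> 'a \<Rightarrow> real" where
  "kernel_comb D k F a = (\<lambda>y. \<Sum>x\<in>F. a x * kernel_section D k x y)"

definition kernel_span :: "'a set \<Rightarrow> ('a \<Rightarrow> 'a \<Rightarrow> real) \<Rightarrow> ('a \<Rightarrow> real) set" where
  "kernel_span D k = {f. \<exists>F a. finite F \<and> F \<subseteq> D \<and> f = kernel_comb D k F a}"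

text \<open>The bilinear extension of \<open>\<langle>k(\<cdot>,x), k(\<cdot>,x')\<rangle> = k(x,x')\<close> to the span; it does not depend on the
  representations of the two functions (lemma \<open>span_inner_comb\<close> below).\<close>

definition span_inner ::
    "'a set \<Rightarrow> ('a \<Rightarrow> 'a \<Rightarrow> real) \<Rightarrow> ('a \<Rightarrow> real) \<Rightarrow> ('a \<Rightarrow> real) \<Rightarrow> real" where
  "span_inner D k f g =
     (THE c. \<exists>F a G b. finite F \<and> F \<subseteq> D \<and> f = kernel_comb D k F a \<and>
                       finite G \<and> G \<subseteq> D \<and> g = kernel_comb D k G b \<and>
                       c = (\<Sum>x\<in>F. \<Sum>y\<in>G. a x * b y * k x y))"

definition span_norm :: "'a set \<Rightarrow> ('a \<Rightarrow> 'a \<Rightarrow> real) \<Rightarrow> ('a \<Rightarrow> real) \<Rightarrow> real" where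
  "span_norm D k f = sqrt (span_inner D k f f)"

text \<open>The functional completion adjoins to the span the pointwise limits of the sequences that are
  Cauchy for its norm.\<close>

definition rkhs_approx ::
    "'a set \<Rightarrow> ('a \<Rightarrow> 'a \<Rightarrow> real) \<Rightarrow> (nat \<Rightarrow> 'a \<Rightarrow> real) \<Rightarrow> ('a \<Rightarrow> real) \<Rightarrow> bool" where
  "rkhs_approx D k s h \<longleftrightarrow>
     (\<forall>n. s n \<in> kernel_span D k) \<and>
     (\<forall>\<epsilon>>0. \<exists>N. \<forall>m\<ge>N. \<forall>n\<ge>N. span_norm D k (\<lambda>x. s m x - s n x) < \<epsilon>) \<and>
     (\<forall>x\<in>D. (\<lambda>n. s n x) \<longlonglongrightarrow> h x)"

definition rkhs :: "'a set \<Rightarrow> ('a \<Rightarrow> 'a \<Rightarrow> real) \<Rightarrow> ('a \<Rightarrow> real) set" where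
  "rkhs D k = {h \<in> fun_space D. \<exists>s. rkhs_approx D k s h}"

definition rkhs_inner ::
    "'a set \<Rightarrow> ('a \<Rightarrow> 'a \<Rightarrow> real) \<Rightarrow> ('a \<Rightarrow> real) \<Rightarrow> ('a \<Rightarrow> real) \<Rightarrow> real" where
  "rkhs_inner D k g h =
     (THE c. \<exists>s t. rkhs_approx D k s g \<and> rkhs_approx D k t h \<and>
                   (\<lambda>n. span_inner D k (s n) (t n)) \<longlonglongrightarrow> c)"

definition rkhs_norm :: "'a set \<Rightarrow> ('a \<Rightarrow> 'a \<Rightarrow> real) \<Rightarrow> ('a \<Rightarrow> real) \<Rightarrow> real" where
  "rkhs_norm D k h = sqrt (rkhs_inner D k h h)"

definition rkhs_converges ::
    "'a set \<Rightarrow> ('a \<Rightarrow> 'a \<Rightarrow> real) \<Rightarrow> (nat \<Rightarrow> 'a \<Rightarrow> real) \<Rightarrow> ('a \<Rightarrow> real) \<Rightarrow> bool" where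
  "rkhs_converges D k s h \<longleftrightarrow>
     (\<forall>n. s n \<in> rkhs D k) \<and> h \<in> rkhs D k \<and>
     (\<lambda>n. rkhs_norm D k (\<lambda>x. s n x - h x)) \<longlonglongrightarrow> 0"

definition associated_operator ::
    "'w measure \<Rightarrow> 'a set \<Rightarrow> ('a \<Rightarrow> 'a \<Rightarrow> real) \<Rightarrow> ('a \<Rightarrow> 'w \<Rightarrow> real) \<Rightarrow>
     (('a \<Rightarrow> real) \<Rightarrow> 'a \<Rightarrow> real) \<Rightarrow> (('a \<Rightarrow> real) \<Rightarrow> 'a \<Rightarrow> real) \<Rightarrow> bool" where
  "associated_operator M D k Z T S \<longleftrightarrow>
     linear_map_on (rkhs D k) (fun_space D) S \<and>
     (\<forall>x\<in>D. \<forall>x'\<in>D. covariance M (apply_paths D T Z x) (Z x') = S (kernel_section D k x') x) \<and>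
     (\<forall>s h. rkhs_converges D k s h \<longrightarrow> (\<forall>x\<in>D. (\<lambda>n. S (s n) x) \<longlonglongrightarrow> S h x))"


section \<open>The inner product on the span is well defined\<close>

lemma span_inner_comb:
  assumes sym: "\<And>x y. x \<in> D \<Longrightarrow> y \<in> D \<Longrightarrow> k x y = k y x"
    and F: "finite F" "F \<subseteq> D" and G: "finite G" "G \<subseteq> D"
  shows "span_inner D k (kernel_comb D k F a) (kernel_comb D k G b) =
    (\<Sum>x\<in>F. \<Sum>y\<in>G. a x * b y * k x y)"
proof -
  have left: "(\<Sum>x\<in>F. \<Sum>y\<in>G. a x * b y * k x y) = (\<Sum>y\<in>G. b y * kernel_comb D k F a y)"
    if "F \<subseteq> D" "G \<subseteq> D" for F G a b
  proof -
    have "(\<Sum>x\<in>F. \<Sum>y\<in>G. a x * b y * k x y) = (\<Sum>y\<in>G. \<Sum>x\<in>F. a x * b y * k x y)"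
      by (rule sum.swap)
    also have "\<dots> = (\<Sum>y\<in>G. b y * kernel_comb D k F a y)"
      using that by (auto intro!: sum.cong simp: kernel_comb_def kernel_section_def on_dom_def
          sum_distrib_left subset_iff sym)
    finally show ?thesis .
  qed
  have right: "(\<Sum>x\<in>F. \<Sum>y\<in>G. a x * b y * k x y) = (\<Sum>x\<in>F. a x * kernel_comb D k G b x)"
    if "F \<subseteq> D" "G \<subseteq> D" for F G a b
    using that by (auto intro!: sum.cong simp: kernel_comb_def kernel_section_def on_dom_def
        sum_distrib_left subset_iff)
  show ?thesis
    unfolding span_inner_def
  proof (rule the_equality)
    fix c
    assume "\<exists>F' a' G' b'. finite F' \<and> F' \<subseteq> D \<and> kernel_comb D k F a = kernel_comb D k F' a' \<and>
        finite G' \<and> G' \<subseteq> D \<and> kernel_comb D k G b = kernel_comb D k G' b' \<and>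
        c = (\<Sum>x\<in>F'. \<Sum>y\<in>G'. a' x * b' y * k x y)"
    then obtain F' a' G' b' where *: "F' \<subseteq> D" "G' \<subseteq> D"
        "kernel_comb D k F a = kernel_comb D k F' a'" "kernel_comb D k G b = kernel_comb D k G' b'"
        "c = (\<Sum>x\<in>F'. \<Sum>y\<in>G'. a' x * b' y * k x y)"
      by blast
    have "c = (\<Sum>y\<in>G'. b' y * kernel_comb D k F a y)"
      using left[OF *(1,2)] * by simp
    also have "\<dots> = (\<Sum>x\<in>F. \<Sum>y\<in>G'. a x * b' y * k x y)"
      using left[OF F(2) *(2)] by simp
    also have "\<dots> = (\<Sum>x\<in>F. a x * kernel_comb D k G b x)"
      using right[OF F(2) *(2)] * by simp
    also have "\<dots> = (\<Sum>x\<in>F. \<Sum>y\<in>G. a x * b y * k x y)"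
      using right[OF F(2) G(2)] by simp
    finally show "c = (\<Sum>x\<in>F. \<Sum>y\<in>G. a x * b y * k x y)" .
  qed (use F G in blast)
qed

lemma span_inner_section:
  assumes "\<And>x y. x \<in> D \<Longrightarrow> y \<in> D \<Longrightarrow> k x y = k y x" "x \<in> D" "x' \<in> D"
  shows "span_inner D k (kernel_section D k x) (kernel_section D k x') = k x x'"
  using span_inner_comb[of D k "{x}" "{x'}" "\<lambda>_. 1" "\<lambda>_. 1"] assms
  by (simp add: kernel_comb_def)

end

theory Submission
  imports Defs
begin

text \<open>
  Write \<open>W x\<close> for the value at \<open>x\<close> of \<open>T\<close> applied to the paths of \<open>Z\<close>. All variables are centred, so
  \<open>\<T> (k(\<cdot>,x')) = k(\<cdot>,x')\<close> says precisely that \<open>W x\<close> and \<open>Z x\<close> have the same \<open>L\<^sup>2\<close> inner product with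
  \<open>Z x'\<close>, for every \<open>x\<close>. If \<open>W x = Z x\<close> almost surely this is clear. Conversely, \<open>W x - Z x\<close> is then
  orthogonal to the span of \<open>Z\<close>, while it lies in the closure of that span, so it vanishes almost
  surely (\<open>AE_eq_of_orthogonal_span\<close>).

  The kernel sections determine the operator on the whole reproducing kernel Hilbert space: it is
  linear, so it fixes their span, and it is sequentially continuous into pointwise convergence, so it
  fixes every limit of the span (\<open>rkhs_operator_eq_id\<close>). The work here is to show that a function
  which is the pointwise limit of a Cauchy sequence of the span is also its limit in the norm of the
  completion (\<open>rkhs_approx_converges\<close>). That norm is defined through approximating sequences, so it
  must first be shown independent of their choice (\<open>rkhs_inner_limit\<close>); this comes down to the fact
  that a Cauchy sequence tending to zero pointwise tends to zero in norm (\<open>span_norm_tendsto_0\<close>), a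
  consequence of the reproducing property. The inner product of the span is positive
  semidefinite because \<open>k\<close> is a covariance kernel (\<open>psd_kernel_of_second_moments\<close>).
\<close>

section \<open>Square-integrable random variables\<close>

lemma square_integrable_mult:
  assumes "square_integrable M X" "square_integrable M Y"
  shows "integrable M (\<lambda>\<omega>. X \<omega> * Y \<omega>)"
proof -
  have "integrable M (\<lambda>\<omega>. (X \<omega>)\<^sup>2 + (Y \<omega>)\<^sup>2)"
    using assms by (auto simp: square_integrable_def)
  moreover have "norm (x * y) \<le> norm (x\<^sup>2 + y\<^sup>2)" for x y :: real
  proof -
    have "2 * \<bar>x * y\<bar> \<le> x\<^sup>2 + y\<^sup>2"
      using sum_squares_bound[of "\<bar>x\<bar>" "\<bar>y\<bar>"] by (simp add: abs_mult)
    thus ?thesis by simp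
  qed
  ultimately show ?thesis
    using assms by (auto simp: square_integrable_def intro: Bochner_Integration.integrable_bound)
qed

lemma square_integrable_add:
  assumes "square_integrable M X" "square_integrable M Y"
  shows "square_integrable M (\<lambda>\<omega>. X \<omega> + Y \<omega>)"
proof -
  have "integrable M (\<lambda>\<omega>. (X \<omega>)\<^sup>2 + (Y \<omega>)\<^sup>2 + 2 * (X \<omega> * Y \<omega>))"
    using assms square_integrable_mult[OF assms] by (auto simp: square_integrable_def)
  thus ?thesis using assms by (auto simp: square_integrable_def power2_sum algebra_simps)
qed

lemma square_integrable_cmult:
  "square_integrable M X \<Longrightarrow> square_integrable M (\<lambda>\<omega>. c * X \<omega>)"
  by (auto simp: square_integrable_def power_mult_distrib)

lemma square_integrable_diff:
  assumes "square_integrable M X" "square_integrable M Y"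
  shows "square_integrable M (\<lambda>\<omega>. X \<omega> - Y \<omega>)"
  using square_integrable_add[OF assms(1) square_integrable_cmult[OF assms(2), of "-1"]] by simp

lemma square_integrable_lincomb:
  assumes "\<And>x. x \<in> F \<Longrightarrow> square_integrable M (Z x)"
  shows "square_integrable M (\<lambda>\<omega>. \<Sum>x\<in>F. a x * Z x \<omega>)"
  using assms
proof (induction F rule: infinite_finite_induct)
  case (insert x F)
  thus ?case
    by (simp add: square_integrable_add square_integrable_cmult)
qed (auto simp: square_integrable_def)

lemma (in prob_space) square_integrable_gaussian:
  assumes "gaussian_rv M X"
  shows "square_integrable M X"
  using assms unfolding gaussian_rv_def
proof (elim disjE exE conjE)
  fix \<mu> \<sigma> :: real
  assume \<sigma>: "0 < \<sigma>" and X: "distributed M lborel X (normal_density \<mu> \<sigma>)"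
  have moment: "integrable M (\<lambda>\<omega>. (X \<omega> - \<mu>) ^ n)" for n
    using distributed_integrable[OF X, of "\<lambda>x. (x - \<mu>) ^ n"] integrable_normal_moment[OF \<sigma>, of \<mu> n]
    by simp
  have "(X \<omega>)\<^sup>2 = (X \<omega> - \<mu>)\<^sup>2 + 2 * \<mu> * (X \<omega> - \<mu>) + \<mu>\<^sup>2" for \<omega>
    by (simp add: power2_eq_square algebra_simps)
  moreover have "integrable M (\<lambda>\<omega>. (X \<omega> - \<mu>)\<^sup>2 + 2 * \<mu> * (X \<omega> - \<mu>) + \<mu>\<^sup>2)"
    using moment[of 1] moment[of 2] by (intro Bochner_Integration.integrable_add) auto
  moreover have "X \<in> borel_measurable M"
    using distributed_measurable[OF X] by simp
  ultimately show ?thesis by (simp add: square_integrable_def)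
next
  fix \<mu> assume [measurable]: "X \<in> borel_measurable M" and "AE \<omega> in M. X \<omega> = \<mu>"
  hence "integrable M (\<lambda>\<omega>. (X \<omega>)\<^sup>2) \<longleftrightarrow> integrable M (\<lambda>\<omega>. \<mu>\<^sup>2)"
    by (intro integrable_cong_AE) auto
  thus ?thesis by (simp add: square_integrable_def)
qed

lemma field_span_add_cmult:
  assumes "Y \<in> field_span D Z" "x \<in> D"
  shows "(\<lambda>\<omega>. Y \<omega> + c * Z x \<omega>) \<in> field_span D Z"
proof -
  obtain F a where F: "finite F" "F \<subseteq> D" "Y = (\<lambda>\<omega>. \<Sum>x\<in>F. a x * Z x \<omega>)"
    using assms by (auto simp: field_span_def)
  define b where "b y = (if y \<in> F then a y else 0) + (if y = x then c else 0)" for y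
  have "(\<Sum>y\<in>insert x F. b y * Z y \<omega>) = Y \<omega> + c * Z x \<omega>" for \<omega>
  proof -
    have "(\<Sum>y\<in>insert x F. b y * Z y \<omega>) =
        (\<Sum>y\<in>insert x F. if y \<in> F then a y * Z y \<omega> else 0)
        + (\<Sum>y\<in>insert x F. if y = x then c * Z x \<omega> else 0)"
      by (auto simp: b_def algebra_simps simp flip: sum.distrib intro!: sum.cong)
    also have "(\<Sum>y\<in>insert x F. if y \<in> F then a y * Z y \<omega> else 0) = Y \<omega>"
      unfolding F(3) using F(1) by (intro sum.mono_neutral_cong_right) auto
    finally show ?thesis using F(1) by (simp add: sum.delta)
  qed
  thus ?thesis unfolding field_span_def using F assms(2)
    by (intro CollectI exI[of _ "insert x F"] exI[of _ b]) auto
qed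

text \<open>The difference \<open>X - Z x\<close> is orthogonal to every element of the span, so by Pythagoras none of
  them is closer to it than \<open>0\<close>. But some are arbitrarily close, since \<open>X\<close> lies in the closed span.\<close>

lemma AE_eq_of_orthogonal_span:
  assumes Z: "\<And>x. x \<in> D \<Longrightarrow> square_integrable M (Z x)"
    and X: "X \<in> gaussian_space M D Z" and x: "x \<in> D"
    and orth: "\<And>y. y \<in> D \<Longrightarrow> (LINT \<omega>|M. X \<omega> * Z y \<omega>) = (LINT \<omega>|M. Z x \<omega> * Z y \<omega>)"
  shows "AE \<omega> in M. X \<omega> = Z x \<omega>"
proof -
  define U where "U \<omega> = X \<omega> - Z x \<omega>" for \<omega>
  have X2: "square_integrable M X" using X by (simp add: gaussian_space_def)
  have U2: "square_integrable M U"
    unfolding U_def using X2 Z x by (intro square_integrable_diff)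
  have UZ: "(LINT \<omega>|M. U \<omega> * Z y \<omega>) = 0" if "y \<in> D" for y
    using orth[OF that] square_integrable_mult[OF X2 Z[OF that]] square_integrable_mult[OF Z[OF x] Z[OF that]]
    by (simp add: U_def left_diff_distrib)
  have small: "sqrt (LINT \<omega>|M. (U \<omega>)\<^sup>2) < \<epsilon>" if \<epsilon>: "\<epsilon> > 0" for \<epsilon>
  proof -
    obtain Y where Y: "Y \<in> field_span D Z" and lt: "sqrt (LINT \<omega>|M. (X \<omega> - Y \<omega>)\<^sup>2) < \<epsilon>"
      using X \<epsilon> by (auto simp: gaussian_space_def)
    define V where "V \<omega> = Y \<omega> + -1 * Z x \<omega>" for \<omega>
    have "V \<in> field_span D Z"
      unfolding V_def using Y x by (rule field_span_add_cmult)
    then obtain F a where F: "finite F" "F \<subseteq> D" "V = (\<lambda>\<omega>. \<Sum>x\<in>F. a x * Z x \<omega>)"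
      by (auto simp: field_span_def)
    have V2: "square_integrable M V"
      unfolding F(3) using F Z by (intro square_integrable_lincomb) auto
    have "(LINT \<omega>|M. U \<omega> * V \<omega>) = (LINT \<omega>|M. (\<Sum>y\<in>F. a y * (U \<omega> * Z y \<omega>)))"
      by (simp add: F(3) sum_distrib_left mult.left_commute)
    also have "\<dots> = (\<Sum>y\<in>F. a y * (LINT \<omega>|M. U \<omega> * Z y \<omega>))"
      using F Z by (subst Bochner_Integration.integral_sum) (auto intro!: square_integrable_mult U2)
    also have "\<dots> = 0" using F UZ by (intro sum.neutral) auto
    finally have UV: "(LINT \<omega>|M. U \<omega> * V \<omega>) = 0" .
    have "(LINT \<omega>|M. (X \<omega> - Y \<omega>)\<^sup>2) = (LINT \<omega>|M. (U \<omega>)\<^sup>2 + (V \<omega>)\<^sup>2 - 2 * (U \<omega> * V \<omega>))"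
      by (intro Bochner_Integration.integral_cong) (auto simp: U_def V_def power2_eq_square algebra_simps)
    also have "\<dots> = (LINT \<omega>|M. (U \<omega>)\<^sup>2) + (LINT \<omega>|M. (V \<omega>)\<^sup>2)"
      using U2 V2 square_integrable_mult[OF U2 V2] UV by (simp add: square_integrable_def)
    finally have "(LINT \<omega>|M. (U \<omega>)\<^sup>2) \<le> (LINT \<omega>|M. (X \<omega> - Y \<omega>)\<^sup>2)" by simp
    with lt show ?thesis by (meson le_less_trans real_sqrt_le_mono)
  qed
  have "sqrt (LINT \<omega>|M. (U \<omega>)\<^sup>2) = 0"
    using small by (metis less_irrefl real_sqrt_ge_zero integral_nonneg_AE AE_I2 zero_le_power2 less_le)
  hence "AE \<omega> in M. (U \<omega>)\<^sup>2 = 0"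
    using U2 by (subst integral_nonneg_eq_0_iff_AE[symmetric]) (auto simp: square_integrable_def)
  thus ?thesis by (auto simp: U_def)
qed


section \<open>The functional completion of the span of a positive semidefinite kernel\<close>

locale psd_kernel =
  fixes D :: "'a set" and k :: "'a \<Rightarrow> 'a \<Rightarrow> real"
  assumes sym: "x \<in> D \<Longrightarrow> y \<in> D \<Longrightarrow> k x y = k y x"
    and psd: "finite F \<Longrightarrow> F \<subseteq> D \<Longrightarrow> 0 \<le> (\<Sum>x\<in>F. \<Sum>y\<in>F. a x * a y * k x y)"
begin

abbreviation "inn \<equiv> span_inner D k"
abbreviation "nrm \<equiv> span_norm D k"
abbreviation "S \<equiv> kernel_span D k"

lemma kernel_comb_in_span: "finite F \<Longrightarrow> F \<subseteq> D \<Longrightarrow> kernel_comb D k F a \<in> S"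
  by (auto simp: kernel_span_def)

lemma kernel_section_in_span: "x \<in> D \<Longrightarrow> kernel_section D k x \<in> S"
  using kernel_comb_in_span[of "{x}" "\<lambda>_. 1"] by (simp add: kernel_comb_def)

lemma span_subset_fun_space: "S \<subseteq> fun_space D"
  by (auto simp: kernel_span_def fun_space_def kernel_comb_def kernel_section_def on_dom_def)

text \<open>Padding coefficients with zeros lets two combinations share their index set, so that they can be
  added coefficientwise.\<close>

lemma kernel_comb_extend:
  assumes "finite G" "F \<subseteq> G"
  shows "kernel_comb D k F a = kernel_comb D k G (\<lambda>x. if x \<in> F then a x else 0)"
  unfolding kernel_comb_def using assms
  by (intro ext sum.mono_neutral_cong_left) auto

lemma span_add_cmult:
  assumes "f \<in> S" "g \<in> S"
  shows "(\<lambda>x. f x + c * g x) \<in> S"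
proof -
  obtain F a G b where *: "finite F" "F \<subseteq> D" "f = kernel_comb D k F a"
      "finite G" "G \<subseteq> D" "g = kernel_comb D k G b"
    using assms by (auto simp: kernel_span_def)
  define a' b' where "a' x = (if x \<in> F then a x else 0)" and "b' x = (if x \<in> G then b x else 0)" for x
  have "f = kernel_comb D k (F \<union> G) a'" "g = kernel_comb D k (F \<union> G) b'"
    unfolding * a'_def b'_def using * by (auto intro: kernel_comb_extend)
  hence "(\<lambda>x. f x + c * g x) = kernel_comb D k (F \<union> G) (\<lambda>x. a' x + c * b' x)"
    by (auto simp: kernel_comb_def sum_distrib_left algebra_simps simp flip: sum.distrib)
  thus ?thesis using * by (auto intro: kernel_comb_in_span)
qed

lemma span_diff: "f \<in> S \<Longrightarrow> g \<in> S \<Longrightarrow> (\<lambda>x. f x - g x) \<in> S"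
  using span_add_cmult[of f g "-1"] by simp

text \<open>The reproducing property, extended linearly from kernel sections to the span. It turns
  pointwise convergence into weak convergence against the span.\<close>

lemma span_inner_comb_left:
  assumes "finite F" "F \<subseteq> D" "g \<in> S"
  shows "inn (kernel_comb D k F a) g = (\<Sum>x\<in>F. a x * g x)"
proof -
  obtain G b where G: "finite G" "G \<subseteq> D" "g = kernel_comb D k G b"
    using assms by (auto simp: kernel_span_def)
  have "inn (kernel_comb D k F a) g = (\<Sum>x\<in>F. \<Sum>y\<in>G. a x * b y * k x y)"
    unfolding G(3) using sym assms G by (intro span_inner_comb) auto
  also have "\<dots> = (\<Sum>x\<in>F. a x * g x)"
    using assms(2) unfolding G(3)
    by (intro sum.cong) (auto simp: kernel_comb_def kernel_section_def on_dom_def sum_distrib_left algebra_simps)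
  finally show ?thesis .
qed

lemma span_inner_add_cmult_right:
  assumes "f \<in> S" "g \<in> S" "h \<in> S"
  shows "inn f (\<lambda>x. g x + c * h x) = inn f g + c * inn f h"
proof -
  obtain F a where F: "finite F" "F \<subseteq> D" "f = kernel_comb D k F a"
    using assms by (auto simp: kernel_span_def)
  show ?thesis unfolding F(3) using F assms span_add_cmult[OF assms(2,3)]
    by (simp add: span_inner_comb_left sum.distrib sum_distrib_left algebra_simps)
qed

lemma span_inner_commute:
  assumes "f \<in> S" "g \<in> S"
  shows "inn f g = inn g f"
proof -
  obtain F a G b where *: "finite F" "F \<subseteq> D" "f = kernel_comb D k F a"
      "finite G" "G \<subseteq> D" "g = kernel_comb D k G b"
    using assms by (auto simp: kernel_span_def)
  have "inn f g = (\<Sum>x\<in>F. \<Sum>y\<in>G. a x * b y * k x y)"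
    unfolding * using sym * by (intro span_inner_comb) auto
  also have "\<dots> = (\<Sum>y\<in>G. \<Sum>x\<in>F. b y * a x * k y x)"
    using * sym by (subst sum.swap) (auto intro!: sum.cong simp: subset_iff)
  also have "\<dots> = inn g f"
    unfolding * using sym * by (intro span_inner_comb[symmetric]) auto
  finally show ?thesis .
qed

lemma span_inner_add_cmult_left:
  assumes "f \<in> S" "g \<in> S" "h \<in> S"
  shows "inn (\<lambda>x. g x + c * h x) f = inn g f + c * inn h f"
  using assms span_inner_add_cmult_right[OF assms] span_add_cmult[OF assms(2,3)]
  by (metis span_inner_commute)

lemma span_inner_diff_right:
  "f \<in> S \<Longrightarrow> g \<in> S \<Longrightarrow> h \<in> S \<Longrightarrow> inn f (\<lambda>x. g x - h x) = inn f g - inn f h"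
  using span_inner_add_cmult_right[of f g h "-1"] by simp

lemma span_inner_diff_left:
  "f \<in> S \<Longrightarrow> g \<in> S \<Longrightarrow> h \<in> S \<Longrightarrow> inn (\<lambda>x. g x - h x) f = inn g f - inn h f"
  using span_inner_add_cmult_left[of f g h "-1"] by simp

lemma span_inner_nonneg:
  assumes "f \<in> S" shows "0 \<le> inn f f"
proof -
  obtain F a where F: "finite F" "F \<subseteq> D" "f = kernel_comb D k F a"
    using assms by (auto simp: kernel_span_def)
  have "inn f f = (\<Sum>x\<in>F. \<Sum>y\<in>F. a x * a y * k x y)"
    unfolding F using sym F by (intro span_inner_comb) auto
  thus ?thesis using psd F by simp
qed

lemma span_norm_nonneg: "f \<in> S \<Longrightarrow> 0 \<le> nrm f"
  by (simp add: span_norm_def span_inner_nonneg)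

lemma span_norm_square: "f \<in> S \<Longrightarrow> (nrm f)\<^sup>2 = inn f f"
  by (simp add: span_norm_def span_inner_nonneg)

lemma span_inner_add_cmult_self:
  assumes "f \<in> S" "g \<in> S"
  shows "inn (\<lambda>x. f x + t * g x) (\<lambda>x. f x + t * g x) = inn f f + 2 * t * inn f g + t\<^sup>2 * inn g g"
  using assms span_add_cmult[OF assms, of t] span_inner_commute[OF assms]
  by (simp add: span_inner_add_cmult_left span_inner_add_cmult_right power2_eq_square algebra_simps)

lemma span_inner_Cauchy_Schwarz:
  assumes "f \<in> S" "g \<in> S"
  shows "\<bar>inn f g\<bar> \<le> nrm f * nrm g"
proof -
  let ?A = "inn f f" and ?B = "inn f g" and ?C = "inn g g"
  have quad: "0 \<le> ?A + 2 * t * ?B + t\<^sup>2 * ?C" for t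
    using span_inner_nonneg[OF span_add_cmult[OF assms, of t]]
    by (simp add: span_inner_add_cmult_self assms)
  have "?B\<^sup>2 \<le> ?A * ?C"
  proof (cases "?C = 0")
    case True
    \<comment> \<open>The quadratic degenerates to an affine function of \<open>t\<close>, which is negative somewhere unless
      its slope vanishes.\<close>
    have "?B = 0"
    proof (rule ccontr)
      assume "?B \<noteq> 0"
      with quad[of "- (?A + 1) / (2 * ?B)"] True show False by (simp add: field_simps)
    qed
    with True show ?thesis by simp
  next
    case False
    hence C: "?C > 0" using span_inner_nonneg[OF assms(2)] by simp
    \<comment> \<open>The quadratic is evaluated at its minimum \<open>t = - B / C\<close>.\<close>
    have "0 \<le> (?A + 2 * (- ?B / ?C) * ?B + (- ?B / ?C)\<^sup>2 * ?C) * ?C"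
      using quad[of "- ?B / ?C"] C by (intro mult_nonneg_nonneg) simp_all
    also have "\<dots> = ?A * ?C - ?B\<^sup>2"
      using C by (simp add: field_simps power2_eq_square)
    finally show ?thesis by simp
  qed
  hence "sqrt (?B\<^sup>2) \<le> sqrt (?A * ?C)" by (rule real_sqrt_le_mono)
  thus ?thesis by (simp add: span_norm_def real_sqrt_mult)
qed

lemma span_norm_add_cmult:
  assumes "f \<in> S" "g \<in> S" "\<bar>c\<bar> = 1"
  shows "nrm (\<lambda>x. f x + c * g x) \<le> nrm f + nrm g"
proof (rule power2_le_imp_le)
  have c2: "c\<^sup>2 = 1" using assms(3) by (metis power2_abs power_one)
  have "c * inn f g \<le> \<bar>c * inn f g\<bar>" by simp
  also have "\<dots> \<le> nrm f * nrm g"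
    using span_inner_Cauchy_Schwarz[OF assms(1,2)] assms(3) by (simp add: abs_mult)
  finally show "(nrm (\<lambda>x. f x + c * g x))\<^sup>2 \<le> (nrm f + nrm g)\<^sup>2"
    using assms span_add_cmult[OF assms(1,2), of c] c2
    by (simp add: span_norm_square span_inner_add_cmult_self power2_sum)
  show "0 \<le> nrm f + nrm g" using assms by (simp add: span_norm_nonneg)
qed

lemma span_norm_diff: "f \<in> S \<Longrightarrow> g \<in> S \<Longrightarrow> nrm (\<lambda>x. f x - g x) \<le> nrm f + nrm g"
  using span_norm_add_cmult[of f g "-1"] by simp

lemma rkhs_approxD:
  assumes "rkhs_approx D k s h"
  shows "s n \<in> S" "x \<in> D \<Longrightarrow> (\<lambda>n. s n x) \<longlonglongrightarrow> h x"
    "\<epsilon> > 0 \<Longrightarrow> \<exists>N. \<forall>m\<ge>N. \<forall>n\<ge>N. nrm (\<lambda>x. s m x - s n x) < \<epsilon>"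
  using assms by (auto simp: rkhs_approx_def)

lemma rkhs_approx_const: "f \<in> S \<Longrightarrow> rkhs_approx D k (\<lambda>_. f) f"
  using span_norm_square[OF span_diff[of f f]] span_inner_diff_right[OF span_diff[of f f], of f f]
  by (simp add: rkhs_approx_def)

lemma span_subset_rkhs: "S \<subseteq> rkhs D k"
  using rkhs_approx_const span_subset_fun_space by (auto simp: rkhs_def)

lemma rkhs_approx_diff:
  assumes s: "rkhs_approx D k s g" and t: "rkhs_approx D k t h"
  shows "rkhs_approx D k (\<lambda>n x. s n x - t n x) (\<lambda>x. g x - h x)"
  unfolding rkhs_approx_def
proof (intro conjI allI impI ballI)
  note S = rkhs_approxD(1)[OF s] rkhs_approxD(1)[OF t]
  show "(\<lambda>x. s n x - t n x) \<in> S" for n using S by (intro span_diff)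
  show "(\<lambda>n. s n x - t n x) \<longlonglongrightarrow> g x - h x" if "x \<in> D" for x
    using rkhs_approxD(2)[OF s that] rkhs_approxD(2)[OF t that] by (rule tendsto_diff)
  fix \<epsilon> :: real assume "\<epsilon> > 0"
  then obtain N1 N2 where N: "\<And>m n. m \<ge> N1 \<Longrightarrow> n \<ge> N1 \<Longrightarrow> nrm (\<lambda>x. s m x - s n x) < \<epsilon> / 2"
     "\<And>m n. m \<ge> N2 \<Longrightarrow> n \<ge> N2 \<Longrightarrow> nrm (\<lambda>x. t m x - t n x) < \<epsilon> / 2"
    using rkhs_approxD(3)[OF s, of "\<epsilon>/2"] rkhs_approxD(3)[OF t, of "\<epsilon>/2"] by (metis half_gt_zero)
  show "\<exists>N. \<forall>m\<ge>N. \<forall>n\<ge>N. nrm (\<lambda>x. (s m x - t m x) - (s n x - t n x)) < \<epsilon>"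
  proof (intro exI[of _ "max N1 N2"] allI impI)
    fix m n assume mn: "max N1 N2 \<le> m" "max N1 N2 \<le> n"
    have "nrm (\<lambda>x. (s m x - t m x) - (s n x - t n x))
        = nrm (\<lambda>x. (s m x - s n x) - (t m x - t n x))" by (simp add: algebra_simps)
    also have "\<dots> \<le> nrm (\<lambda>x. s m x - s n x) + nrm (\<lambda>x. t m x - t n x)"
      by (intro span_norm_diff span_diff S)
    also have "\<dots> < \<epsilon>" using N(1)[of m n] N(2)[of m n] mn by simp
    finally show "nrm (\<lambda>x. (s m x - t m x) - (s n x - t n x)) < \<epsilon>" .
  qed
qed

lemma rkhs_approx_bounded:
  assumes s: "rkhs_approx D k s h"
  obtains K where "K > 0" "\<And>n. nrm (s n) \<le> K"
proof -
  note S = rkhs_approxD(1)[OF s]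
  obtain N where N: "\<And>m n. m \<ge> N \<Longrightarrow> n \<ge> N \<Longrightarrow> nrm (\<lambda>x. s m x - s n x) < 1"
    using rkhs_approxD(3)[OF s, of 1] by auto
  have tail: "nrm (s n) \<le> nrm (s N) + 1" if "n \<ge> N" for n
  proof -
    have "nrm (s n) = nrm (\<lambda>x. (s n x - s N x) + 1 * s N x)" by simp
    also have "\<dots> \<le> nrm (\<lambda>x. s n x - s N x) + nrm (s N)"
      by (intro span_norm_add_cmult span_diff S) auto
    finally show ?thesis using N[of n N] that by simp
  qed
  define K where "K = nrm (s N) + 1 + (\<Sum>n<N. nrm (s n))"
  have "0 \<le> (\<Sum>n<N. nrm (s n))" by (intro sum_nonneg span_norm_nonneg S)
  moreover have "nrm (s n) \<le> (\<Sum>n<N. nrm (s n))" if "n < N" for n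
    using that by (intro member_le_sum span_norm_nonneg S) auto
  ultimately have "nrm (s n) \<le> K" for n
    using tail[of n] span_norm_nonneg[OF S[of N]] by (cases "n < N") (fastforce simp: K_def)+
  moreover have "K > 0"
    using \<open>0 \<le> (\<Sum>n<N. nrm (s n))\<close> span_norm_nonneg[OF S[of N]] by (simp add: K_def)
  ultimately show ?thesis using that by blast
qed

text \<open>A Cauchy sequence in the span that tends to zero pointwise tends to zero in norm. This is what
  makes the completion a space of functions: no nonzero element of the abstract completion is
  invisible pointwise. Split \<open>\<langle>u n, u n\<rangle> = \<langle>u N, u n\<rangle> + \<langle>u n - u N, u n\<rangle>\<close>; by the reproducing
  property the first term tends to zero for fixed \<open>N\<close>, and the second is small for large \<open>N\<close>.\<close>

lemma span_norm_tendsto_0: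
  assumes u: "rkhs_approx D k u h" and h: "\<And>x. x \<in> D \<Longrightarrow> h x = 0"
  shows "(\<lambda>n. nrm (u n)) \<longlonglongrightarrow> 0"
proof -
  note S = rkhs_approxD(1)[OF u]
  obtain K where K: "K > 0" "\<And>n. nrm (u n) \<le> K" using rkhs_approx_bounded[OF u] by blast
  have "(\<lambda>n. inn (u n) (u n)) \<longlonglongrightarrow> 0"
  proof (rule LIMSEQ_I)
    fix \<epsilon> :: real assume \<epsilon>: "\<epsilon> > 0"
    obtain N where N: "\<And>m n. m \<ge> N \<Longrightarrow> n \<ge> N \<Longrightarrow> nrm (\<lambda>x. u m x - u n x) < \<epsilon> / (2 * K)"
      using rkhs_approxD(3)[OF u, of "\<epsilon> / (2 * K)"] \<epsilon> K by auto
    obtain F a where F: "finite F" "F \<subseteq> D" "u N = kernel_comb D k F a"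
      using S[of N] by (auto simp: kernel_span_def)
    have "(\<lambda>n. \<Sum>x\<in>F. a x * u n x) \<longlonglongrightarrow> (\<Sum>x\<in>F. a x * 0)"
      using F h rkhs_approxD(2)[OF u] by (intro tendsto_sum tendsto_mult tendsto_const) (force simp: subset_iff)
    hence "(\<lambda>n. inn (u N) (u n)) \<longlonglongrightarrow> 0"
      using F S by (simp add: span_inner_comb_left)
    then obtain N' where N': "\<And>n. n \<ge> N' \<Longrightarrow> \<bar>inn (u N) (u n)\<bar> < \<epsilon> / 2"
      using LIMSEQ_D[of _ 0 "\<epsilon> / 2"] \<epsilon> by fastforce
    show "\<exists>no. \<forall>n\<ge>no. norm (inn (u n) (u n) - 0) < \<epsilon>"
    proof (intro exI[of _ "max N N'"] allI impI)
      fix n assume n: "max N N' \<le> n"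
      have "inn (\<lambda>x. u n x - u N x) (u n) = inn (u n) (u n) - inn (u N) (u n)"
        by (intro span_inner_diff_left S)
      moreover have "\<bar>inn (\<lambda>x. u n x - u N x) (u n)\<bar> \<le> nrm (\<lambda>x. u n x - u N x) * nrm (u n)"
        by (intro span_inner_Cauchy_Schwarz span_diff S)
      moreover have "nrm (\<lambda>x. u n x - u N x) * nrm (u n) \<le> \<epsilon> / (2 * K) * K"
        using N[of n N] n K \<epsilon> by (intro mult_mono span_norm_nonneg S) auto
      moreover have "\<epsilon> / (2 * K) * K = \<epsilon> / 2" using K by simp
      ultimately show "norm (inn (u n) (u n) - 0) < \<epsilon>" using N'[of n] n by simp
    qed
  qed
  hence "(\<lambda>n. sqrt (inn (u n) (u n))) \<longlonglongrightarrow> sqrt 0" by (rule tendsto_real_sqrt)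
  thus ?thesis by (simp add: span_norm_def)
qed

lemma span_inner_diff_bound:
  assumes "f \<in> S" "g \<in> S" "f' \<in> S" "g' \<in> S"
  shows "\<bar>inn f g - inn f' g'\<bar> \<le> nrm (\<lambda>x. f x - f' x) * nrm g + nrm f' * nrm (\<lambda>x. g x - g' x)"
proof -
  have "inn f g - inn f' g' = inn (\<lambda>x. f x - f' x) g + inn f' (\<lambda>x. g x - g' x)"
    using assms by (simp add: span_inner_diff_left span_inner_diff_right)
  thus ?thesis
    using span_inner_Cauchy_Schwarz[OF span_diff[OF assms(1,3)] assms(2)]
      span_inner_Cauchy_Schwarz[OF assms(3) span_diff[OF assms(2,4)]] by linarith
qed

lemma span_inner_approx_convergent:
  assumes s: "rkhs_approx D k s g" and t: "rkhs_approx D k t h"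
  shows "convergent (\<lambda>n. inn (s n) (t n))"
proof (rule Cauchy_convergent, rule CauchyI)
  note S = rkhs_approxD(1)[OF s] rkhs_approxD(1)[OF t]
  obtain K where K: "K > 0" "\<And>n. nrm (s n) \<le> K" using rkhs_approx_bounded[OF s] by blast
  obtain L where L: "L > 0" "\<And>n. nrm (t n) \<le> L" using rkhs_approx_bounded[OF t] by blast
  fix \<epsilon> :: real assume \<epsilon>: "\<epsilon> > 0"
  obtain N1 where N1: "\<And>m n. m \<ge> N1 \<Longrightarrow> n \<ge> N1 \<Longrightarrow> nrm (\<lambda>x. s m x - s n x) < \<epsilon> / (2 * L)"
    using rkhs_approxD(3)[OF s, of "\<epsilon> / (2 * L)"] \<epsilon> L by auto
  obtain N2 where N2: "\<And>m n. m \<ge> N2 \<Longrightarrow> n \<ge> N2 \<Longrightarrow> nrm (\<lambda>x. t m x - t n x) < \<epsilon> / (2 * K)"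
    using rkhs_approxD(3)[OF t, of "\<epsilon> / (2 * K)"] \<epsilon> K by auto
  show "\<exists>N. \<forall>m\<ge>N. \<forall>n\<ge>N. norm (inn (s m) (t m) - inn (s n) (t n)) < \<epsilon>"
  proof (intro exI[of _ "max N1 N2"] allI impI)
    fix m n assume mn: "max N1 N2 \<le> m" "max N1 N2 \<le> n"
    have "nrm (\<lambda>x. s m x - s n x) * nrm (t m) \<le> nrm (\<lambda>x. s m x - s n x) * L"
      by (intro mult_left_mono L span_norm_nonneg span_diff S)
    also have "\<dots> < \<epsilon> / (2 * L) * L"
      using N1[of m n] mn L by (intro mult_strict_right_mono) auto
    finally have 1: "nrm (\<lambda>x. s m x - s n x) * nrm (t m) < \<epsilon> / 2" using L by simp
    have "nrm (s n) * nrm (\<lambda>x. t m x - t n x) \<le> K * nrm (\<lambda>x. t m x - t n x)"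
      by (intro mult_right_mono K span_norm_nonneg span_diff S)
    also have "\<dots> < K * (\<epsilon> / (2 * K))"
      using N2[of m n] mn K by (intro mult_strict_left_mono) auto
    finally have 2: "nrm (s n) * nrm (\<lambda>x. t m x - t n x) < \<epsilon> / 2" using K by simp
    from 1 2 show "norm (inn (s m) (t m) - inn (s n) (t n)) < \<epsilon>"
      using span_inner_diff_bound[OF S(1)[of m] S(2)[of m] S(1)[of n] S(2)[of n]] by simp
  qed
qed

text \<open>Two approximating sequences of the same function differ by a null sequence, so the limit does
  not depend on the choice and the inner product of the completion is well defined.\<close>

lemma rkhs_inner_limit:
  assumes s: "rkhs_approx D k s g" and t: "rkhs_approx D k t h"
  shows "(\<lambda>n. inn (s n) (t n)) \<longlonglongrightarrow> rkhs_inner D k g h"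
proof -
  obtain c where c: "(\<lambda>n. inn (s n) (t n)) \<longlonglongrightarrow> c"
    using span_inner_approx_convergent[OF s t] by (auto simp: convergent_def)
  have "rkhs_inner D k g h = c"
    unfolding rkhs_inner_def
  proof (rule the_equality)
    fix c' assume "\<exists>s t. rkhs_approx D k s g \<and> rkhs_approx D k t h \<and> (\<lambda>n. inn (s n) (t n)) \<longlonglongrightarrow> c'"
    then obtain s' t' where s': "rkhs_approx D k s' g" and t': "rkhs_approx D k t' h"
      and c': "(\<lambda>n. inn (s' n) (t' n)) \<longlonglongrightarrow> c'" by blast
    note S = rkhs_approxD(1)[OF s] rkhs_approxD(1)[OF t] rkhs_approxD(1)[OF s'] rkhs_approxD(1)[OF t']
    obtain K where K: "K > 0" "\<And>n. nrm (s' n) \<le> K" using rkhs_approx_bounded[OF s'] by blast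
    obtain L where L: "L > 0" "\<And>n. nrm (t n) \<le> L" using rkhs_approx_bounded[OF t] by blast
    have null: "(\<lambda>n. nrm (\<lambda>x. s n x - s' n x)) \<longlonglongrightarrow> 0" "(\<lambda>n. nrm (\<lambda>x. t n x - t' n x)) \<longlonglongrightarrow> 0"
      using span_norm_tendsto_0[OF rkhs_approx_diff[OF s s']]
        span_norm_tendsto_0[OF rkhs_approx_diff[OF t t']] by simp_all
    have "(\<lambda>n. inn (s n) (t n) - inn (s' n) (t' n)) \<longlonglongrightarrow> 0"
    proof (rule tendsto_rabs_zero_cancel, rule real_tendsto_sandwich[where f = "\<lambda>_. 0"])
      show "(\<lambda>n. nrm (\<lambda>x. s n x - s' n x) * L + K * nrm (\<lambda>x. t n x - t' n x)) \<longlonglongrightarrow> 0"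
        using tendsto_add[OF tendsto_mult_right[OF null(1), of L] tendsto_mult_left[OF null(2), of K]] by simp
      show "\<forall>\<^sub>F n in sequentially. \<bar>inn (s n) (t n) - inn (s' n) (t' n)\<bar>
          \<le> nrm (\<lambda>x. s n x - s' n x) * L + K * nrm (\<lambda>x. t n x - t' n x)"
      proof (intro always_eventually allI)
        fix n
        show "\<bar>inn (s n) (t n) - inn (s' n) (t' n)\<bar>
          \<le> nrm (\<lambda>x. s n x - s' n x) * L + K * nrm (\<lambda>x. t n x - t' n x)"
          by (rule order_trans[OF span_inner_diff_bound])
            (intro S add_mono mult_left_mono mult_right_mono K L span_norm_nonneg span_diff)+
      qed
    qed auto
    from LIMSEQ_unique[OF this tendsto_diff[OF c c']] show "c' = c" by simp
  qed (use s t c in blast)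
  with c show ?thesis by simp
qed

lemma rkhs_norm_limit:
  assumes "rkhs_approx D k s h"
  shows "(\<lambda>n. nrm (s n)) \<longlonglongrightarrow> rkhs_norm D k h"
  unfolding span_norm_def rkhs_norm_def
  by (intro tendsto_real_sqrt rkhs_inner_limit assms)

text \<open>The span is dense in the completion: the distance from \<open>s n\<close> to \<open>h\<close> is the limit of the
  distances from \<open>s n\<close> to \<open>s m\<close>, which the Cauchy property bounds.\<close>

lemma rkhs_approx_converges:
  assumes h: "h \<in> rkhs D k" and s: "rkhs_approx D k s h"
  shows "rkhs_converges D k s h"
  unfolding rkhs_converges_def
proof (intro conjI allI h)
  note S = rkhs_approxD(1)[OF s]
  show "s n \<in> rkhs D k" for n using S span_subset_rkhs by blast
  have lim: "(\<lambda>m. nrm (\<lambda>x. s n x - s m x)) \<longlonglongrightarrow> rkhs_norm D k (\<lambda>x. s n x - h x)" for n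
    by (intro rkhs_norm_limit rkhs_approx_diff rkhs_approx_const S s)
  show "(\<lambda>n. rkhs_norm D k (\<lambda>x. s n x - h x)) \<longlonglongrightarrow> 0"
  proof (rule LIMSEQ_I)
    fix \<epsilon> :: real assume \<epsilon>: "\<epsilon> > 0"
    obtain N where N: "\<And>m n. m \<ge> N \<Longrightarrow> n \<ge> N \<Longrightarrow> nrm (\<lambda>x. s m x - s n x) < \<epsilon> / 2"
      using rkhs_approxD(3)[OF s, of "\<epsilon> / 2"] \<epsilon> by auto
    have "\<bar>rkhs_norm D k (\<lambda>x. s n x - h x)\<bar> < \<epsilon>" if "n \<ge> N" for n
    proof -
      have "rkhs_norm D k (\<lambda>x. s n x - h x) \<le> \<epsilon> / 2"
        using N[OF that] by (intro LIMSEQ_le_const2[OF lim]) (auto intro: less_imp_le)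
      moreover have "0 \<le> rkhs_norm D k (\<lambda>x. s n x - h x)"
        by (intro LIMSEQ_le_const[OF lim]) (auto intro: span_norm_nonneg span_diff S)
      ultimately show ?thesis using \<epsilon> by simp
    qed
    thus "\<exists>no. \<forall>n\<ge>no. norm (rkhs_norm D k (\<lambda>x. s n x - h x) - 0) < \<epsilon>" by auto
  qed
qed

lemma linear_map_on_comb:
  assumes A: "linear_map_on (rkhs D k) W A" and F: "finite F" "F \<subseteq> D"
  shows "A (kernel_comb D k F a) = (\<lambda>y. \<Sum>x\<in>F. a x * A (kernel_section D k x) y)"
  using F
proof (induction F rule: finite_induct)
  case empty
  \<comment> \<open>\<open>A 0 = A (0 * 0) = 0 * A 0\<close>.\<close>
  have "kernel_comb D k {} a \<in> rkhs D k"
    using kernel_comb_in_span[of "{}" a] span_subset_rkhs by auto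
  hence "A (\<lambda>y. 0 * kernel_comb D k {} a y) = (\<lambda>y. 0 * A (kernel_comb D k {} a) y)"
    using A unfolding linear_map_on_def by blast
  thus ?case by (simp add: kernel_comb_def)
next
  case (insert x F)
  have sec: "kernel_section D k x \<in> S" using insert by (intro kernel_section_in_span) auto
  have cmult: "(\<lambda>y. a x * kernel_section D k x y) \<in> S"
    using kernel_comb_in_span[of "{x}" a] insert by (simp add: kernel_comb_def)
  have comb: "kernel_comb D k F a \<in> S" using insert by (intro kernel_comb_in_span) auto
  have "kernel_comb D k (insert x F) a = (\<lambda>y. a x * kernel_section D k x y + kernel_comb D k F a y)"
    using insert by (simp add: kernel_comb_def)
  hence "A (kernel_comb D k (insert x F) a) =
      (\<lambda>y. A (\<lambda>y. a x * kernel_section D k x y) y + A (kernel_comb D k F a) y)"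
    using A subsetD[OF span_subset_rkhs cmult] subsetD[OF span_subset_rkhs comb]
    by (simp add: linear_map_on_def)
  also have "A (\<lambda>y. a x * kernel_section D k x y) = (\<lambda>y. a x * A (kernel_section D k x) y)"
    using A sec span_subset_rkhs unfolding linear_map_on_def by auto
  finally show ?case using insert by simp
qed

text \<open>By linearity \<open>A\<close> fixes the span. Since the span is dense in norm, and \<open>A\<close> turns norm convergence
  into pointwise convergence, both \<open>A h\<close> and \<open>h\<close> are pointwise limits of the same sequence.\<close>

lemma rkhs_operator_eq_id:
  assumes A: "linear_map_on (rkhs D k) (fun_space D) A"
    and cont: "\<And>s h x. rkhs_converges D k s h \<Longrightarrow> x \<in> D \<Longrightarrow> (\<lambda>n. A (s n) x) \<longlonglongrightarrow> A h x"
    and sec: "\<And>x. x \<in> D \<Longrightarrow> A (kernel_section D k x) = kernel_section D k x"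
    and h: "h \<in> rkhs D k"
  shows "A h = h"
proof
  fix x
  have span: "A f = f" if f: "f \<in> S" for f
  proof -
    obtain F a where F: "finite F" "F \<subseteq> D" "f = kernel_comb D k F a"
      using f by (auto simp: kernel_span_def)
    have "A f = (\<lambda>y. \<Sum>x\<in>F. a x * A (kernel_section D k x) y)"
      unfolding F(3) using A F(1,2) by (rule linear_map_on_comb)
    also have "\<dots> = f"
      using F sec by (auto simp: kernel_comb_def subset_iff intro!: sum.cong)
    finally show ?thesis .
  qed
  show "A h x = h x"
  proof (cases "x \<in> D")
    case True
    obtain s where s: "rkhs_approx D k s h" using h by (auto simp: rkhs_def)
    have "(\<lambda>n. A (s n) x) \<longlonglongrightarrow> A h x"
      using cont[OF rkhs_approx_converges[OF h s] True] .
    moreover have "A (s n) = s n" for n using rkhs_approxD(1)[OF s] by (rule span)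
    ultimately have "(\<lambda>n. s n x) \<longlonglongrightarrow> A h x" by simp
    with rkhs_approxD(2)[OF s True] show ?thesis by (rule LIMSEQ_unique[symmetric])
  next
    case False
    thus ?thesis using A h by (auto simp: linear_map_on_def rkhs_def fun_space_def)
  qed
qed

end


section \<open>Covariance kernels and the equivalence\<close>

text \<open>The quadratic form of \<open>k\<close> with coefficients \<open>a\<close> is the second moment of \<open>\<Sum>x\<in>F. a x * Z x\<close>.\<close>

lemma psd_kernel_of_second_moments:
  assumes Z: "\<And>x. x \<in> D \<Longrightarrow> square_integrable M (Z x)"
    and k: "\<And>x y. x \<in> D \<Longrightarrow> y \<in> D \<Longrightarrow> (LINT \<omega>|M. Z x \<omega> * Z y \<omega>) = k x y"
  shows "psd_kernel D k"
proof
  fix x y assume "x \<in> D" "y \<in> D"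
  thus "k x y = k y x" by (simp add: mult.commute flip: k)
next
  fix F a assume F: "finite F" "F \<subseteq> D"
  have int: "integrable M (\<lambda>\<omega>. a x * a y * (Z x \<omega> * Z y \<omega>))" if "x \<in> F" "y \<in> F" for x y
    using F that Z by (intro integrable_mult_right square_integrable_mult) auto
  have "0 \<le> (LINT \<omega>|M. (\<Sum>x\<in>F. a x * Z x \<omega>)\<^sup>2)" by simp
  also have "\<dots> = (LINT \<omega>|M. (\<Sum>x\<in>F. \<Sum>y\<in>F. a x * a y * (Z x \<omega> * Z y \<omega>)))"
    by (simp add: power2_eq_square sum_product mult_ac)
  also have "\<dots> = (\<Sum>x\<in>F. \<Sum>y\<in>F. (LINT \<omega>|M. a x * a y * (Z x \<omega> * Z y \<omega>)))"
    using int by (simp add: Bochner_Integration.integral_sum)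
  also have "\<dots> = (\<Sum>x\<in>F. \<Sum>y\<in>F. a x * a y * k x y)"
    using F by (intro sum.cong refl) (auto simp: k subset_iff)
  finally show "0 \<le> (\<Sum>x\<in>F. \<Sum>y\<in>F. a x * a y * k x y)" .
qed

theorem proposition7:
  fixes D :: "(real ^ 'd) set"
    and M :: "'w measure"
    and Z :: "real ^ 'd \<Rightarrow> 'w \<Rightarrow> real"
    and k :: "real ^ 'd \<Rightarrow> real ^ 'd \<Rightarrow> real"
    and T \<T> :: "(real ^ 'd \<Rightarrow> real) \<Rightarrow> real ^ 'd \<Rightarrow> real"
  assumes "compact D"
    and "prob_space M"
    and "centred_gaussian_field M D Z"
    and "\<And>x x'. x \<in> D \<Longrightarrow> x' \<in> D \<Longrightarrow> covariance M (Z x) (Z x') = k x x'"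
    and "continuous_on (D \<times> D) (\<lambda>(x, x'). k x x')"
    and "\<And>\<omega>. \<omega> \<in> space M \<Longrightarrow> sample_path D Z \<omega> \<in> cont_fun_space D"
    and "linear_map_on (cont_fun_space D) (fun_space D) T"
    and "\<And>x. x \<in> D \<Longrightarrow> square_integrable M (apply_paths D T Z x)"
    and "\<And>x. x \<in> D \<Longrightarrow> integral\<^sup>L M (apply_paths D T Z x) = 0"
    and "\<And>x. x \<in> D \<Longrightarrow> apply_paths D T Z x \<in> gaussian_space M D Z"
    and "associated_operator M D k Z T \<T>"
  shows "((\<forall>x\<in>D. measure M {\<omega> \<in> space M. Z x \<omega> = apply_paths D T Z x \<omega>} = 1) \<longleftrightarrow>
            (\<forall>x'\<in>D. \<T> (kernel_section D k x') = kernel_section D k x'))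
       \<and> ((\<forall>x'\<in>D. \<T> (kernel_section D k x') = kernel_section D k x') \<longleftrightarrow>
            (\<forall>h\<in>rkhs D k. \<T> h = h))"
proof -
  interpret prob_space M by fact
  define W where "W = apply_paths D T Z"
  have Z2: "square_integrable M (Z x)" if "x \<in> D" for x
  proof -
    have "gaussian_rv M (\<lambda>\<omega>. \<Sum>y\<in>{x}. 1 * Z y \<omega>)"
      using assms(3) that unfolding centred_gaussian_field_def
      by (elim conjE allE[of _ "{x}"] allE[of _ "\<lambda>_. 1"]) auto
    thus ?thesis by (simp add: square_integrable_gaussian)
  qed
  have meanZ: "integral\<^sup>L M (Z x) = 0" if "x \<in> D" for x
    using assms(3) that by (simp add: centred_gaussian_field_def)
  have momentZ: "(LINT \<omega>|M. Z x \<omega> * Z y \<omega>) = k x y" if "x \<in> D" "y \<in> D" for x y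
    using assms(4)[OF that] meanZ that by (simp add: covariance_def)
  interpret psd_kernel D k
    using Z2 momentZ by (rule psd_kernel_of_second_moments)
  have W: "W x \<in> gaussian_space M D Z" "square_integrable M (W x)" "integral\<^sup>L M (W x) = 0"
    if "x \<in> D" for x
    using assms(8-10) that by (auto simp: W_def)
  have lin: "linear_map_on (rkhs D k) (fun_space D) \<T>"
    and cont: "\<And>s h x. rkhs_converges D k s h \<Longrightarrow> x \<in> D \<Longrightarrow> (\<lambda>n. \<T> (s n) x) \<longlonglongrightarrow> \<T> h x"
    using assms(11) by (auto simp: associated_operator_def)
  have momentW: "(LINT \<omega>|M. W x \<omega> * Z y \<omega>) = \<T> (kernel_section D k y) x"
    if "x \<in> D" "y \<in> D" for x y
    using assms(11) that meanZ W by (simp add: associated_operator_def covariance_def W_def)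
  have meas [measurable]: "Z x \<in> borel_measurable M" "W x \<in> borel_measurable M" if "x \<in> D" for x
    using Z2 W(2) that by (auto simp: square_integrable_def)
  have AE_iff: "measure M {\<omega> \<in> space M. Z x \<omega> = W x \<omega>} = 1 \<longleftrightarrow> (AE \<omega> in M. W x \<omega> = Z x \<omega>)"
    if "x \<in> D" for x
  proof -
    have "{\<omega> \<in> space M. Z x \<omega> = W x \<omega>} \<in> events"
      using meas[OF that] by measurable
    thus ?thesis by (subst prob_Collect_eq_1) (auto simp: eq_commute)
  qed
  have moments: "(\<T> (kernel_section D k y) = kernel_section D k y) \<longleftrightarrow>
      (\<forall>x\<in>D. (LINT \<omega>|M. W x \<omega> * Z y \<omega>) = (LINT \<omega>|M. Z x \<omega> * Z y \<omega>))" if y: "y \<in> D" for y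
  proof -
    have "kernel_section D k y \<in> rkhs D k"
      using kernel_section_in_span[OF y] span_subset_rkhs by blast
    hence "\<T> (kernel_section D k y) \<in> fun_space D"
      using lin by (auto simp: linear_map_on_def)
    hence "(\<T> (kernel_section D k y) = kernel_section D k y) \<longleftrightarrow>
        (\<forall>x\<in>D. \<T> (kernel_section D k y) x = k x y)"
      by (auto simp: fun_eq_iff fun_space_def kernel_section_def on_dom_def)
    thus ?thesis using y by (simp add: momentW momentZ)
  qed
  have "(\<forall>x\<in>D. AE \<omega> in M. W x \<omega> = Z x \<omega>) \<longleftrightarrow>
      (\<forall>y\<in>D. \<T> (kernel_section D k y) = kernel_section D k y)"
  proof
    assume "\<forall>x\<in>D. AE \<omega> in M. W x \<omega> = Z x \<omega>"
    hence "(LINT \<omega>|M. W x \<omega> * Z y \<omega>) = (LINT \<omega>|M. Z x \<omega> * Z y \<omega>)" if "x \<in> D" "y \<in> D" for x y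
      using that by (intro integral_cong_AE borel_measurable_times meas) auto
    thus "\<forall>y\<in>D. \<T> (kernel_section D k y) = kernel_section D k y" using moments by blast
  next
    assume "\<forall>y\<in>D. \<T> (kernel_section D k y) = kernel_section D k y"
    thus "\<forall>x\<in>D. AE \<omega> in M. W x \<omega> = Z x \<omega>"
      using moments Z2 W(1) by (intro ballI AE_eq_of_orthogonal_span) auto
  qed
  moreover have "(\<forall>y\<in>D. \<T> (kernel_section D k y) = kernel_section D k y) \<longleftrightarrow>
      (\<forall>h\<in>rkhs D k. \<T> h = h)"
  proof
    assume "\<forall>y\<in>D. \<T> (kernel_section D k y) = kernel_section D k y"
    thus "\<forall>h\<in>rkhs D k. \<T> h = h"
      using rkhs_operator_eq_id[OF lin cont] by blast
  next
    assume "\<forall>h\<in>rkhs D k. \<T> h = h"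
    thus "\<forall>y\<in>D. \<T> (kernel_section D k y) = kernel_section D k y"
      using kernel_section_in_span span_subset_rkhs by blast
  qed
  ultimately show ?thesis using AE_iff by (simp add: W_def)
qed

end
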